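(* Consider the control setting of the context, with memory parameters $(H,\varepsilon)$, horizon $T$ and reference policy class $\Pi$. Let $\mathcal L'$ be the class of $\alpha$-strongly convex, $\beta$-smooth and $G$-bounded loss functions, from which the losses $\ell_t$ encountered by the booster are taken. Assume oracle access to $N$ copies $\mathcal A_1,\dots,\mathcal A_N$ of a weak controller $\mathcal A$, with regret function $R(T)$, satisfying the truncated-memory regret guarantee (∗) of the context with respect to the class $\mathcal L$ of $\alpha$-strongly convex quadratic functions. Then there exists a boosting algorithm (DynaBoost2, described in the context) which produces a sequence of actions $u_1,\dots,u_T$ for which the following regret bound holds with respect to the reference class $\Pi$: $$\sum_{t=1}^T \ell_t(u_1,\dots,u_t)-\min_{\pi\in\Pi}\sum_{t=1}^T \ell_t(u_1^{\pi},\dots,u_t^{\pi})\;\le\;\Big(1-\frac{\alpha}{\beta}\Big)^N 2GT+R(T)+4T\varepsilon .$$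
   Context: **System.** At each round $t\in[T]$ the controller observes the state $x_t\in\mathbb R^k$ and outputs an action $u_t\in\mathcal U\subset\mathbb R^d$, where $\mathcal U$ is a convex bounded set. An adversary then reveals a convex cost function $c_t$, the loss $c_t(x_t,u_t)$ is incurred, and the system moves to $x_{t+1}=f(x_t,u_t)+w_t$, where $f$ is the dynamics and $w_t\in\mathbb R^k$ is an adversarially chosen perturbation with $\|w_t\|_2\le W$. Costs and perturbations are revealed after the controller commits to $u_t$; no distributional assumption is made. Comparators face the same costs and perturbations. **Losses.** $\ell_t(u_1,\dots,u_t)$ denotes the loss $c_t(x_t,u_t)$ at round $t$, where $x_t$ is the state reached with actions $u_1,u_2,\dots$ and the realized perturbations. For a sequence of actions, let $\hat x_t$ be the state reached if one artificially sets $x_{t-H+1}=0$ and simulates the system with the actions $u_{t-H+1},\dots,u_t$. The proxy loss, which depends only on the last $H$ actions, is $\ell_t(\mathbf 0,u_{t-H+1},\dots,u_t):=c_t(\hat x_t,u_t)$. **Bounded memory.** A sequence of actions $u_1,\dots,u_T$ is of $(H,\varepsilon)$-bounded memory if $|c_t(\hat x_t,u_t)-c_t(x_t,u_t)|\le\varepsilon$ for all $t$. Standing assumption: for the given system, the class of $(H,\varepsilon)$-bounded-memory sequences is closed under convex combination. **Policies.** $\Pi$ is a class of policies $\pi$, each mapping a sequence of perturbations $w_1,\dots,w_{t-1}$ to an action $u_t^\pi$. Standing assumption: the policies considered induce bounded memory, i.e. their action sequences are of $(H,\varepsilon)$-bounded memory. **Smoothness, strong convexity, boundedness.** Let $\ell$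 be a loss function of $H$ actions, with $\nabla_j$ the gradient in the $j$-th action. It is $\beta$-smooth if for all $u_1,\dots,u_H$ and $\tilde u_1,\dots,\tilde u_H$, $$\ell(u_1,\dots,u_H)-\ell(\tilde u_1,\dots,\tilde u_H)\le\sum_{j=1}^H\nabla_j\ell(\tilde u_1,\dots,\tilde u_H)^\top(u_j-\tilde u_j)+\frac{\beta}{2}\sum_{j}\|u_j-\tilde u_j\|_2^2 ;$$ it is $\alpha$-strongly convex if for all such points $$\ell(u_1,\dots,u_H)-\ell(\tilde u_1,\dots,\tilde u_H)\ge\sum_{j=1}^H\nabla_j\ell(\tilde u_1,\dots,\tilde u_H)^\top(u_j-\tilde u_j)+\frac{\alpha}{2}\sum_{j}\|u_j-\tilde u_j\|_2^2 ;$$ it is $G$-bounded if $|\ell(u_1,\dots,u_H)|\le G$ for all $u_1,\dots,u_H\in\mathcal U$. For the losses $\ell_t$ these properties refer to the proxy loss as a function of its $H$ actions. **Weak controller.** An online learning algorithm $\mathcal A_i$ for the system and reference class $\Pi$ (its output at round $t$ is written $\mathcal A_i(x_t)$ and is computed from its internal state) is a weak controller with respect to a class $\mathcal L$ of losses if: (1) the sequence of actions it produces is of $(H,\varepsilon)$-bounded memory; (2) when run with losses $\ell_t^i\in\mathcal L$ it produces actions $u_1,\dots,u_T$ with $$\sum_{t=1}^T \ell_t^i(u_1,\dots,u_t)-\min_{\pi\in\Pi}\sum_{t=1}^T \ell_t^i(u_1^\pi,\dots,u_t^\pi)\le R(T),$$ where $R(T)$ is a non-decreasing sublinear function of $T$.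 The truncated-memory guarantee assumed in the claim is that, for losses $\ell_t^i\in\mathcal L$ of the $H$ most recent actions passed to $\mathcal A_i$ and its own actions $u_t$, $$\sum_{t=1}^T \ell_t^i(u_{t-H+1},\dots,u_t)-\min_{\pi\in\Pi}\sum_{t=1}^T \ell_t^i(u_{t-H+1}^\pi,\dots,u_t^\pi)\le R(T)+2T\varepsilon. \qquad (∗)$$ **DynaBoost2.** Set $\eta_i=\frac{\alpha}{\beta}$ for $i\in[N]$. At each round $t=1,\dots,T$: receive $x_t$; put $u_t^0=\mathbf 0$ and, for $i=1,\dots,N$, $u_t^i=(1-\eta_i)u_t^{i-1}+\eta_i\mathcal A_i(x_t)$; output $u_t=u_t^N$; receive $\ell_t$ and suffer $\ell_t(u_1,\dots,u_t)$; for each $i\in[N]$ pass to $\mathcal A_i$ the quadratic loss $$\ell_t^i(v_1,\dots,v_H)=\sum_{j=1}^H\frac{\eta_i\beta}{2}\|v_j-u_{t-H+j}^{i-1}\|^2+\sum_{j=1}^H\nabla_j^\top(v_j-u_{t-H+j}^{i-1}),$$ where $\nabla_j$ is the gradient of $\ell_t(\mathbf 0,u_{t-H+1}^{i-1},\dots,u_t^{i-1})$ with respect to the action at time $t-H+j$.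
   Formalization: The formal theorem additionally assumes that the zero action lies in U and that the zero action sequence (the start u_t^0 = 0 of DynaBoost2) is of (H,ε)-bounded memory, without which the bound can fail; R is also taken with R(0) ≥ 0. *)

theory Defs
  imports "HOL-Analysis.Analysis"
begin

text \<open>
  Rounds are numbered from 1; the value of a sequence at index 0 is never used.  A tuple
  \<open>(v\<^sub>1, \<dots>, v\<^sub>H)\<close> of actions is a function on \<^typ>\<open>nat\<close> of which only the values on
  \<open>{1..H}\<close> matter.
\<close>

type_synonym 'u window_loss = "(nat \<Rightarrow> 'u) \<Rightarrow> real"

text \<open>
  A controller is a deterministic causal map: in round \<open>t\<close> it sees the states \<open>x\<^sub>1, \<dots>, x\<^sub>t\<close>, the
  perturbations \<open>w\<^sub>1, \<dots>, w\<^bsub>t-1\<^esub>\<close> and the losses passed to it in rounds \<open>1, \<dots>, t - 1\<close>.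
  Its internal state is a function of this history.
\<close>

type_synonym ('x, 'u) controller = "'x list \<Rightarrow> 'x list \<Rightarrow> 'u window_loss list \<Rightarrow> 'u"

text \<open>A policy maps \<open>w\<^sub>1, \<dots>, w\<^bsub>t-1\<^esub>\<close> to the action of round \<open>t\<close>.\<close>

type_synonym ('x, 'u) policy = "'x list \<Rightarrow> 'u"

definition policy_actions :: "(nat \<Rightarrow> 'x) \<Rightarrow> ('x, 'u) policy \<Rightarrow> nat \<Rightarrow> 'u" where
  "policy_actions w \<pi> t = \<pi> (map w [1..<t])"


subsection \<open>System, losses, bounded memory\<close>

text \<open>The state of round \<open>t\<close>, with \<open>x1\<close> the state of round 1 (and a dummy value at \<open>t = 0\<close>).\<close>

primrec state_at ::
  "('x::real_normed_vector \<Rightarrow> 'u \<Rightarrow> 'x) \<Rightarrow> 'x \<Rightarrow> (nat \<Rightarrow> 'x) \<Rightarrow> (nat \<Rightarrow> 'u) \<Rightarrow> nat \<Rightarrow> 'x" where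
  "state_at f x1 w u 0 = x1"
| "state_at f x1 w u (Suc t) = (if t = 0 then x1 else f (state_at f x1 w u t) (u t) + w t)"

definition loss ::
  "('x::real_normed_vector \<Rightarrow> 'u \<Rightarrow> 'x) \<Rightarrow> 'x \<Rightarrow> (nat \<Rightarrow> 'x) \<Rightarrow> (nat \<Rightarrow> 'x \<Rightarrow> 'u \<Rightarrow> real) \<Rightarrow>
    (nat \<Rightarrow> 'u) \<Rightarrow> nat \<Rightarrow> real" where
  "loss f x1 w c u t = c t (state_at f x1 w u t) (u t)"

text \<open>
  The window \<open>(s\<^bsub>t-H+1\<^esub>, \<dots>, s\<^sub>t)\<close> of a sequence; entry \<open>j\<close> belongs to round \<open>t - H + j\<close>, and
  rounds before the first one are padded with 0.
\<close>

definition window :: "nat \<Rightarrow> nat \<Rightarrow> (nat \<Rightarrow> 'a::zero) \<Rightarrow> nat \<Rightarrow> 'a" where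
  "window H t s = (\<lambda>j. if 1 \<le> j \<and> j \<le> H \<and> H < t + j then s (t + j - H) else 0)"

text \<open>
  Simulation from the artificial state 0 at window position 1: \<open>simulate f z v n\<close> is the state at
  window position \<open>n + 1\<close>, where \<open>z\<close> and \<open>v\<close> are the windows of perturbations and actions.
\<close>

primrec simulate ::
  "('x::real_normed_vector \<Rightarrow> 'u \<Rightarrow> 'x) \<Rightarrow> (nat \<Rightarrow> 'x) \<Rightarrow> (nat \<Rightarrow> 'u) \<Rightarrow> nat \<Rightarrow> 'x" where
  "simulate f z v 0 = 0"
| "simulate f z v (Suc n) = f (simulate f z v n) (v (Suc n)) + z (Suc n)"

text \<open>The function \<open>(v\<^sub>1, \<dots>, v\<^sub>H) \<mapsto> \<ell>\<^sub>t(\<zero>, v\<^sub>1, \<dots>, v\<^sub>H)\<close>; window position \<open>H\<close> is round \<open>t\<close>.\<close>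

definition proxy_loss ::
  "('x::real_normed_vector \<Rightarrow> 'u \<Rightarrow> 'x) \<Rightarrow> (nat \<Rightarrow> 'x) \<Rightarrow> (nat \<Rightarrow> 'x \<Rightarrow> 'u \<Rightarrow> real) \<Rightarrow>
    nat \<Rightarrow> nat \<Rightarrow> 'u window_loss" where
  "proxy_loss f w c H t v = c t (simulate f (window H t w) v (H - 1)) (v H)"

text \<open>The sequences considered are sequences of actions, hence the membership in \<open>\<U>\<close>.\<close>

definition bounded_memory ::
  "('x::real_normed_vector \<Rightarrow> 'u::zero \<Rightarrow> 'x) \<Rightarrow> 'x \<Rightarrow> (nat \<Rightarrow> 'x) \<Rightarrow> (nat \<Rightarrow> 'x \<Rightarrow> 'u \<Rightarrow> real) \<Rightarrow>
    'u set \<Rightarrow> nat \<Rightarrow> nat \<Rightarrow> real \<Rightarrow> (nat \<Rightarrow> 'u) \<Rightarrow> bool" where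
  "bounded_memory f x1 w c \<U> T H \<epsilon> u \<longleftrightarrow>
    (\<forall>t\<in>{1..T}. u t \<in> \<U> \<and> \<bar>proxy_loss f w c H t (window H t u) - loss f x1 w c u t\<bar> \<le> \<epsilon>)"


subsection \<open>Losses of \<open>H\<close> actions\<close>

definition has_gradients :: "nat \<Rightarrow> 'u::real_inner window_loss \<Rightarrow> bool" where
  "has_gradients H L \<longleftrightarrow> (\<forall>v. \<forall>j\<in>{1..H}. \<exists>D. GDERIV (\<lambda>a. L (v(j := a))) (v j) :> D)"

definition gradient :: "nat \<Rightarrow> 'u::real_inner window_loss \<Rightarrow> (nat \<Rightarrow> 'u) \<Rightarrow> 'u" where
  "gradient j L v = (THE D. GDERIV (\<lambda>a. L (v(j := a))) (v j) :> D)"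

definition smooth :: "nat \<Rightarrow> real \<Rightarrow> 'u::real_inner window_loss \<Rightarrow> bool" where
  "smooth H \<beta> L \<longleftrightarrow> has_gradients H L \<and>
    (\<forall>v v'. L v - L v' \<le>
      (\<Sum>j=1..H. gradient j L v' \<bullet> (v j - v' j)) + \<beta> / 2 * (\<Sum>j=1..H. (norm (v j - v' j))\<^sup>2))"

definition strongly_convex :: "nat \<Rightarrow> real \<Rightarrow> 'u::real_inner window_loss \<Rightarrow> bool" where
  "strongly_convex H \<alpha> L \<longleftrightarrow> has_gradients H L \<and>
    (\<forall>v v'. L v - L v' \<ge>
      (\<Sum>j=1..H. gradient j L v' \<bullet> (v j - v' j)) + \<alpha> / 2 * (\<Sum>j=1..H. (norm (v j - v' j))\<^sup>2))"

definition bounded_loss :: "'u set \<Rightarrow> nat \<Rightarrow> real \<Rightarrow> 'u window_loss \<Rightarrow> bool" where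
  "bounded_loss \<U> H G L \<longleftrightarrow> (\<forall>v. (\<forall>j\<in>{1..H}. v j \<in> \<U>) \<longrightarrow> \<bar>L v\<bar> \<le> G)"

definition quadratic :: "nat \<Rightarrow> 'u::real_inner window_loss \<Rightarrow> bool" where
  "quadratic H q \<longleftrightarrow> (\<exists>M b a. (\<forall>j k. linear (M j k)) \<and>
    (\<forall>v. q v = (\<Sum>j=1..H. \<Sum>k=1..H. v j \<bullet> M j k (v k)) + (\<Sum>j=1..H. b j \<bullet> v j) + a))"

text \<open>The loss class of the booster and the loss class of the weak controllers.\<close>

definition booster_losses :: "'u::real_inner set \<Rightarrow> nat \<Rightarrow> real \<Rightarrow> real \<Rightarrow> real \<Rightarrow> 'u window_loss set" where
  "booster_losses \<U> H \<alpha> \<beta> G = {L. strongly_convex H \<alpha> L \<and> smooth H \<beta> L \<and> bounded_loss \<U> H G L}"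

definition weak_losses :: "nat \<Rightarrow> real \<Rightarrow> 'u::real_inner window_loss set" where
  "weak_losses H \<alpha> = {q. quadratic H q \<and> strongly_convex H \<alpha> q}"


subsection \<open>Regret\<close>

text \<open>
  The minimum over the reference class is rendered as an infimum, with which it agrees whenever
  it is attained.
\<close>

definition regret ::
  "('x::real_normed_vector \<Rightarrow> 'u \<Rightarrow> 'x) \<Rightarrow> 'x \<Rightarrow> (nat \<Rightarrow> 'x) \<Rightarrow> (nat \<Rightarrow> 'x \<Rightarrow> 'u \<Rightarrow> real) \<Rightarrow>
    ('x, 'u) policy set \<Rightarrow> nat \<Rightarrow> (nat \<Rightarrow> 'u) \<Rightarrow> real" where
  "regret f x1 w c \<P> T u =
    (\<Sum>t=1..T. loss f x1 w c u t) - (INF \<pi>\<in>\<P>. \<Sum>t=1..T. loss f x1 w c (policy_actions w \<pi>) t)"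

definition truncated_regret ::
  "(nat \<Rightarrow> 'x) \<Rightarrow> nat \<Rightarrow> (nat \<Rightarrow> 'u::zero window_loss) \<Rightarrow> ('x, 'u) policy set \<Rightarrow> nat \<Rightarrow>
    (nat \<Rightarrow> 'u) \<Rightarrow> real" where
  "truncated_regret w H q \<P> T u =
    (\<Sum>t=1..T. q t (window H t u)) - (INF \<pi>\<in>\<P>. \<Sum>t=1..T. q t (window H t (policy_actions w \<pi>)))"

text \<open>
  Non-negativity at 0 is the regret guarantee for the empty horizon; with monotonicity it makes
  \<open>R\<close> non-negative.
\<close>

definition regret_bound :: "(nat \<Rightarrow> real) \<Rightarrow> bool" where
  "regret_bound R \<longleftrightarrow> mono R \<and> 0 \<le> R 0 \<and> (\<lambda>T. R T / real T) \<longlonglongrightarrow> 0"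


subsection \<open>DynaBoost2\<close>

text \<open>
  The quadratic loss passed to a weak controller when \<open>z\<close> is the window of actions
  \<open>u\<^bsub>t-H+1\<^esub>, \<dots>, u\<^sub>t\<close> of the preceding stage.
\<close>

definition surrogate_loss ::
  "real \<Rightarrow> real \<Rightarrow> nat \<Rightarrow> 'u::real_inner window_loss \<Rightarrow> (nat \<Rightarrow> 'u) \<Rightarrow> 'u window_loss" where
  "surrogate_loss \<eta> \<beta> H L z v =
    (\<Sum>j=1..H. \<eta> * \<beta> / 2 * (norm (v j - z j))\<^sup>2) + (\<Sum>j=1..H. gradient j L z \<bullet> (v j - z j))"

text \<open>
  \<open>\<A> i\<close> is copy \<open>i\<close> of the weak controller.
  \<open>stage_action \<A> \<alpha> \<beta> H x w L i t\<close> is the action of stage \<open>i\<close> in round \<open>t\<close> when the booster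
  observes the states \<open>x\<close>, the perturbations \<open>w\<close> and the proxy losses \<open>L\<close>; all step sizes are
  \<open>\<alpha> / \<beta>\<close>.  In round \<open>t\<close> only \<open>x\<^sub>1, \<dots>, x\<^sub>t\<close>, \<open>w\<^sub>1, \<dots>, w\<^bsub>t-1\<^esub>\<close> and the losses of rounds
  \<open>1, \<dots>, t - 1\<close> are used.
\<close>

primrec stage_action ::
  "(nat \<Rightarrow> ('x, 'u::real_inner) controller) \<Rightarrow> real \<Rightarrow> real \<Rightarrow> nat \<Rightarrow>
    (nat \<Rightarrow> 'x) \<Rightarrow> (nat \<Rightarrow> 'x) \<Rightarrow> (nat \<Rightarrow> 'u window_loss) \<Rightarrow> nat \<Rightarrow> nat \<Rightarrow> 'u" where
  "stage_action \<A> \<alpha> \<beta> H x w L 0 = (\<lambda>t. 0)"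
| "stage_action \<A> \<alpha> \<beta> H x w L (Suc i) = (\<lambda>t.
    (1 - \<alpha> / \<beta>) *\<^sub>R stage_action \<A> \<alpha> \<beta> H x w L i t +
    (\<alpha> / \<beta>) *\<^sub>R \<A> (Suc i) (map x [1..<Suc t]) (map w [1..<t])
      (map (\<lambda>s. surrogate_loss (\<alpha> / \<beta>) \<beta> H (L s)
        (window H s (stage_action \<A> \<alpha> \<beta> H x w L i))) [1..<t]))"

text \<open>The loss passed to copy \<open>i \<ge> 1\<close> in round \<open>t\<close>, and the action of copy \<open>i\<close> in round \<open>t\<close>.\<close>

definition passed_loss ::
  "(nat \<Rightarrow> ('x, 'u::real_inner) controller) \<Rightarrow> real \<Rightarrow> real \<Rightarrow> nat \<Rightarrow>
    (nat \<Rightarrow> 'x) \<Rightarrow> (nat \<Rightarrow> 'x) \<Rightarrow> (nat \<Rightarrow> 'u window_loss) \<Rightarrow> nat \<Rightarrow> nat \<Rightarrow> 'u window_loss" where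
  "passed_loss \<A> \<alpha> \<beta> H x w L i t =
    surrogate_loss (\<alpha> / \<beta>) \<beta> H (L t) (window H t (stage_action \<A> \<alpha> \<beta> H x w L (i - 1)))"

definition weak_action ::
  "(nat \<Rightarrow> ('x, 'u::real_inner) controller) \<Rightarrow> real \<Rightarrow> real \<Rightarrow> nat \<Rightarrow>
    (nat \<Rightarrow> 'x) \<Rightarrow> (nat \<Rightarrow> 'x) \<Rightarrow> (nat \<Rightarrow> 'u window_loss) \<Rightarrow> nat \<Rightarrow> nat \<Rightarrow> 'u" where
  "weak_action \<A> \<alpha> \<beta> H x w L i t =
    \<A> i (map x [1..<Suc t]) (map w [1..<t]) (map (passed_loss \<A> \<alpha> \<beta> H x w L i) [1..<t])"

lemma stage_action_weak_action:
  "stage_action \<A> \<alpha> \<beta> H x w L (Suc i) t =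
    (1 - \<alpha> / \<beta>) *\<^sub>R stage_action \<A> \<alpha> \<beta> H x w L i t +
    (\<alpha> / \<beta>) *\<^sub>R weak_action \<A> \<alpha> \<beta> H x w L (Suc i) t"
  by (simp add: weak_action_def passed_loss_def[abs_def])

lemma stage_action_cong:
  assumes "\<And>s. 1 \<le> s \<Longrightarrow> s \<le> t \<Longrightarrow> x s = x' s"
    and "\<And>s. 1 \<le> s \<Longrightarrow> s < t \<Longrightarrow> w s = w' s"
    and "\<And>s. 1 \<le> s \<Longrightarrow> s < t \<Longrightarrow> L s = L' s"
  shows "stage_action \<A> \<alpha> \<beta> H x w L i t = stage_action \<A> \<alpha> \<beta> H x' w' L' i t"
  using assms
proof (induction i arbitrary: t)
  case 0
  then show ?case by simp
next
  case (Suc i)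
  have "window H s (stage_action \<A> \<alpha> \<beta> H x w L i) = window H s (stage_action \<A> \<alpha> \<beta> H x' w' L' i)"
    if "s < t" for s
  proof
    fix j
    show "window H s (stage_action \<A> \<alpha> \<beta> H x w L i) j = window H s (stage_action \<A> \<alpha> \<beta> H x' w' L' i) j"
      using that Suc.prems by (auto simp: window_def intro!: Suc.IH)
  qed
  moreover have "stage_action \<A> \<alpha> \<beta> H x w L i t = stage_action \<A> \<alpha> \<beta> H x' w' L' i t"
    using Suc.prems by (intro Suc.IH) auto
  moreover have "map x [1..<Suc t] = map x' [1..<Suc t]" "map w [1..<t] = map w' [1..<t]"
    using Suc.prems by (auto simp del: upt_Suc)
  moreover have "map (\<lambda>s. surrogate_loss (\<alpha> / \<beta>) \<beta> H (L s)
        (window H s (stage_action \<A> \<alpha> \<beta> H x w L i))) [1..<t] =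
      map (\<lambda>s. surrogate_loss (\<alpha> / \<beta>) \<beta> H (L' s)
        (window H s (stage_action \<A> \<alpha> \<beta> H x' w' L' i))) [1..<t]"
    using calculation(1) Suc.prems(3) by (intro map_cong) auto
  ultimately show ?case
    by (simp only: stage_action.simps)
qed

text \<open>The booster as a controller: the current round is the number of states seen so far.\<close>

definition dynaboost2 ::
  "(nat \<Rightarrow> ('x, 'u::real_inner) controller) \<Rightarrow> nat \<Rightarrow> real \<Rightarrow> real \<Rightarrow> nat \<Rightarrow> ('x, 'u) controller" where
  "dynaboost2 \<A> N \<alpha> \<beta> H xs ws ls =
    stage_action \<A> \<alpha> \<beta> H (\<lambda>s. xs ! (s - 1)) (\<lambda>s. ws ! (s - 1)) (\<lambda>s. ls ! (s - 1)) N (length xs)"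


subsection \<open>Closed loop of a controller and the system\<close>

primrec played_list ::
  "('x::real_normed_vector \<Rightarrow> 'u \<Rightarrow> 'x) \<Rightarrow> 'x \<Rightarrow> (nat \<Rightarrow> 'x) \<Rightarrow> (nat \<Rightarrow> 'u window_loss) \<Rightarrow>
    ('x, 'u) controller \<Rightarrow> nat \<Rightarrow> 'u list" where
  "played_list f x1 w L K 0 = []"
| "played_list f x1 w L K (Suc n) =
    (let us = played_list f x1 w L K n; x = state_at f x1 w (\<lambda>s. us ! (s - 1))
     in us @ [K (map x [1..<Suc (Suc n)]) (map w [1..<Suc n]) (map L [1..<Suc n])])"

definition played ::
  "('x::real_normed_vector \<Rightarrow> 'u \<Rightarrow> 'x) \<Rightarrow> 'x \<Rightarrow> (nat \<Rightarrow> 'x) \<Rightarrow> (nat \<Rightarrow> 'u window_loss) \<Rightarrow>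
    ('x, 'u) controller \<Rightarrow> nat \<Rightarrow> 'u" where
  "played f x1 w L K t = played_list f x1 w L K t ! (t - 1)"

lemma length_played_list [simp]: "length (played_list f x1 w L K n) = n"
  by (induction n) (auto simp: Let_def)

lemma played_list_nth:
  "1 \<le> s \<Longrightarrow> s \<le> n \<Longrightarrow> played_list f x1 w L K n ! (s - 1) = played f x1 w L K s"
proof (induction n)
  case (Suc n)
  then show ?case
    by (cases "s = Suc n") (auto simp: played_def Let_def nth_append)
qed simp

lemma state_at_cong:
  assumes "\<And>s. 1 \<le> s \<Longrightarrow> s < t \<Longrightarrow> u s = v s"
  shows "state_at f x1 w u t = state_at f x1 w v t"
  using assms by (induction t) auto

lemma played_eq:
  assumes "1 \<le> t"
  shows "played f x1 w L K t =
    K (map (state_at f x1 w (played f x1 w L K)) [1..<Suc t]) (map w [1..<t]) (map L [1..<t])"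
proof -
  obtain n where t: "t = Suc n" using assms by (cases t) auto
  have "map (state_at f x1 w (\<lambda>s. played_list f x1 w L K n ! (s - 1))) [1..<Suc t] =
      map (state_at f x1 w (played f x1 w L K)) [1..<Suc t]"
    by (intro map_cong refl state_at_cong played_list_nth) (auto simp: t)
  moreover have "played f x1 w L K t =
      K (map (state_at f x1 w (\<lambda>s. played_list f x1 w L K n ! (s - 1))) [1..<Suc t])
        (map w [1..<t]) (map L [1..<t])"
    by (simp add: played_def t Let_def nth_append del: upt_Suc)
  ultimately show ?thesis
    by (simp only:)
qed

lemma played_dynaboost2:
  assumes "1 \<le> t" and u: "u = played f x1 w L (dynaboost2 \<A> N \<alpha> \<beta> H)"
  shows "u t = stage_action \<A> \<alpha> \<beta> H (state_at f x1 w u) w L N t"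
proof -
  have "u t = dynaboost2 \<A> N \<alpha> \<beta> H (map (state_at f x1 w u) [1..<Suc t]) (map w [1..<t]) (map L [1..<t])"
    unfolding u by (rule played_eq[OF assms(1)])
  also have "\<dots> = stage_action \<A> \<alpha> \<beta> H (state_at f x1 w u) w L N t"
    unfolding dynaboost2_def length_map length_upt diff_Suc_1
    by (rule stage_action_cong) (auto simp del: upt_Suc)
  finally show ?thesis .
qed

end

(*
  One boosting stage is a Frank-Wolfe step whose linear oracle is replaced by the weak controller.
  With step size eta = alpha / beta, smoothness bounds the decrease of the proxy loss along the step
  by eta times the passed quadratic loss, and strong convexity bounds that quadratic loss at a
  comparator by the difference of proxy losses.  Hence the excess D_i of stage i over a comparator
  satisfies D_i <= (1 - eta) D_(i-1) + eta (R(T) + 2 T eps).  Iterating from D_0 <= 2 G T, and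
  paying T eps twice for the passage between proxy losses and losses, gives the bound.
*)
theory Submission
  imports Defs
begin

section \<open>The passed quadratic loss: gradients, curvature, lower bound\<close>

lemma surrogate_loss_sum:
  "surrogate_loss \<eta> \<beta> H L z v =
    (\<Sum>j=1..H. \<eta> * \<beta> / 2 * (norm (v j - z j))\<^sup>2 + gradient j L z \<bullet> (v j - z j))"
  by (simp add: surrogate_loss_def sum.distrib)

text \<open>A Frechet derivative is unique and its inner products determine the representing vector,
  so the \<open>THE\<close> in \<open>gradient\<close> picks out whichever derivative has been
  exhibited.\<close>

lemma gradient_eqI:
  assumes "GDERIV (\<lambda>a. L (v(j := a))) (v j) :> D"
  shows "gradient j L v = D"
  unfolding gradient_def
proof (rule the_equality)
  fix D'
  assume "GDERIV (\<lambda>a. L (v(j := a))) (v j) :> D'"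
  with assms have "(\<lambda>h. h \<bullet> D') = (\<lambda>h. h \<bullet> D)"
    unfolding gderiv_def using has_derivative_unique by blast
  then have "\<forall>h. h \<bullet> D' = h \<bullet> D"
    by (simp add: fun_eq_iff)
  then show "D' = D"
    by (simp only: vector_eq_ldot)
qed (fact assms)

lemma GDERIV_surrogate_loss:
  assumes "j \<in> {1..H}"
  shows "GDERIV (\<lambda>a. surrogate_loss \<eta> \<beta> H L z (v(j := a))) (v j) :>
    (\<eta> * \<beta>) *\<^sub>R (v j - z j) + gradient j L z"
proof -
  let ?g = "\<lambda>k. gradient k L z"
  let ?C = "\<Sum>k\<in>{1..H} - {j}. \<eta> * \<beta> / 2 * (norm (v k - z k))\<^sup>2 + ?g k \<bullet> (v k - z k)"
  \<comment> \<open>The loss is separable across window positions: only summand \<open>j\<close>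
    depends on \<open>a\<close>, and \<open>?C\<close> collects the rest as a constant.\<close>
  have "surrogate_loss \<eta> \<beta> H L z (v(j := a)) =
      \<eta> * \<beta> / 2 * ((a - z j) \<bullet> (a - z j)) + ?g j \<bullet> (a - z j) + ?C" for a
    unfolding surrogate_loss_sum sum.remove[OF finite_atLeastAtMost assms]
    by (simp add: power2_norm_eq_inner)
  moreover have "((\<lambda>a. \<eta> * \<beta> / 2 * ((a - z j) \<bullet> (a - z j)) + ?g j \<bullet> (a - z j) + ?C)
      has_derivative (\<lambda>h. h \<bullet> ((\<eta> * \<beta>) *\<^sub>R (v j - z j) + ?g j))) (at (v j))"
    by (auto intro!: derivative_eq_intros simp: inner_simps inner_commute algebra_simps)
  ultimately show ?thesis
    by (simp add: gderiv_def)
qed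

lemma gradient_surrogate_loss:
  assumes "j \<in> {1..H}"
  shows "gradient j (surrogate_loss \<eta> \<beta> H L z) v = (\<eta> * \<beta>) *\<^sub>R (v j - z j) + gradient j L z"
  by (rule gradient_eqI[OF GDERIV_surrogate_loss[OF assms]])

text \<open>The second-order expansion of this quadratic around \<open>v'\<close> is exact with
  curvature \<eta>\<beta> in every coordinate, so the defining inequality holds with equality, term
  by term.\<close>

lemma strongly_convex_surrogate_loss:
  "strongly_convex H (\<eta> * \<beta>) (surrogate_loss \<eta> \<beta> H L z)"
  unfolding strongly_convex_def
proof (intro conjI allI)
  show "has_gradients H (surrogate_loss \<eta> \<beta> H L z)"
    unfolding has_gradients_def using GDERIV_surrogate_loss by blast
  fix v v'
  let ?q = "surrogate_loss \<eta> \<beta> H L z"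
  have "?q v - ?q v' =
    (\<Sum>j=1..H. ((\<eta> * \<beta>) *\<^sub>R (v' j - z j) + gradient j L z) \<bullet> (v j - v' j)
      + \<eta> * \<beta> / 2 * (norm (v j - v' j))\<^sup>2)"
    unfolding surrogate_loss_sum sum_subtractf[symmetric]
    by (intro sum.cong refl)
      (simp add: power2_norm_eq_inner inner_simps inner_commute field_simps)
  also have "\<dots> = (\<Sum>j=1..H. gradient j ?q v' \<bullet> (v j - v' j))
      + \<eta> * \<beta> / 2 * (\<Sum>j=1..H. (norm (v j - v' j))\<^sup>2)"
    by (simp add: sum.distrib sum_distrib_left gradient_surrogate_loss)
  finally show "(\<Sum>j=1..H. gradient j ?q v' \<bullet> (v j - v' j))
      + \<eta> * \<beta> / 2 * (\<Sum>j=1..H. (norm (v j - v' j))\<^sup>2) \<le> ?q v - ?q v'"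
    by simp
qed

lemma quadratic_surrogate_loss: "quadratic H (surrogate_loss \<eta> \<beta> H L z)"
proof -
  \<comment> \<open>The coefficients come from expanding the squares: a diagonal quadratic part,
    then the linear part, then the constant.\<close>
  let ?M = "\<lambda>j k a. if j = k then (\<eta> * \<beta> / 2) *\<^sub>R a else 0"
  let ?b = "\<lambda>j. gradient j L z - (\<eta> * \<beta>) *\<^sub>R z j"
  let ?a = "\<Sum>j=1..H. \<eta> * \<beta> / 2 * (z j \<bullet> z j) - gradient j L z \<bullet> z j"
  have "linear (?M j k)" for j k :: nat
    by (auto intro!: linearI simp: algebra_simps)
  moreover have "surrogate_loss \<eta> \<beta> H L z v =
      (\<Sum>j=1..H. \<Sum>k=1..H. v j \<bullet> ?M j k (v k)) + (\<Sum>j=1..H. ?b j \<bullet> v j) + ?a" for v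
  proof -
    have "(\<Sum>k=1..H. v j \<bullet> ?M j k (v k)) = \<eta> * \<beta> / 2 * (v j \<bullet> v j)" if "j \<in> {1..H}" for j
    proof -
      have "(\<Sum>k=1..H. v j \<bullet> ?M j k (v k)) =
          (\<Sum>k=1..H. if j = k then \<eta> * \<beta> / 2 * (v j \<bullet> v j) else 0)"
        by (intro sum.cong) auto
      then show ?thesis using that by (simp add: sum.delta')
    qed
    then have "(\<Sum>j=1..H. \<Sum>k=1..H. v j \<bullet> ?M j k (v k)) =
        (\<Sum>j=1..H. \<eta> * \<beta> / 2 * (v j \<bullet> v j))"
      by (intro sum.cong refl)
    moreover have "surrogate_loss \<eta> \<beta> H L z v =
        (\<Sum>j=1..H. \<eta> * \<beta> / 2 * (v j \<bullet> v j)) + (\<Sum>j=1..H. ?b j \<bullet> v j) + ?a"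
      unfolding surrogate_loss_sum sum.distrib[symmetric]
      by (intro sum.cong refl)
        (simp add: power2_norm_eq_inner inner_simps inner_commute field_simps)
    ultimately show ?thesis by simp
  qed
  ultimately show ?thesis
    unfolding quadratic_def
    by (intro exI[of _ ?M] exI[of _ ?b] exI[of _ ?a] conjI allI)
qed

lemma surrogate_loss_weak:
  assumes "\<eta> * \<beta> = \<alpha>"
  shows "surrogate_loss \<eta> \<beta> H L z \<in> weak_losses H \<alpha>"
  using strongly_convex_surrogate_loss[of H \<eta> \<beta> L z] quadratic_surrogate_loss[of H \<eta> \<beta> L z] assms
  by (simp add: weak_losses_def)

text \<open>Completing the square in each coordinate leaves a bound independent of \<open>v\<close>.
  It makes the comparator losses bounded below, so that their infimum over the policies is a genuine
  lower bound.\<close>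

lemma surrogate_loss_lower_bound:
  assumes "0 < \<eta> * \<beta>"
  shows "- (\<Sum>j=1..H. (norm (gradient j L z))\<^sup>2 / (2 * (\<eta> * \<beta>))) \<le> surrogate_loss \<eta> \<beta> H L z v"
  unfolding surrogate_loss_sum sum_negf[symmetric]
proof (rule sum_mono)
  fix j
  define s y g where "s = \<eta> * \<beta>" and "y = v j - z j" and "g = gradient j L z"
  have "s > 0" using assms by (simp add: s_def)
  have "0 \<le> s / 2 * (norm (y + (1 / s) *\<^sub>R g))\<^sup>2"
    using \<open>s > 0\<close> by simp
  also have "\<dots> = s / 2 * (norm y)\<^sup>2 + g \<bullet> y + (norm g)\<^sup>2 / (2 * s)"
    using \<open>s > 0\<close>
    by (simp add: power2_norm_eq_inner inner_simps inner_commute field_simps)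
  finally show "- ((norm (gradient j L z))\<^sup>2 / (2 * (\<eta> * \<beta>))) \<le>
      \<eta> * \<beta> / 2 * (norm (v j - z j))\<^sup>2 + gradient j L z \<bullet> (v j - z j)"
    by (simp add: s_def y_def g_def)
qed

section \<open>Inequalities for one boosting stage\<close>

text \<open>The passed loss is the first-order expansion of \<open>L\<close> at \<open>z\<close>
  plus a quadratic term whose coefficient is exactly that of strong convexity with modulus
  \<eta>\<beta>.\<close>

lemma surrogate_loss_le_diff:
  assumes "strongly_convex H (\<eta> * \<beta>) L"
  shows "surrogate_loss \<eta> \<beta> H L z v \<le> L v - L z"
proof -
  have "(\<Sum>j=1..H. gradient j L z \<bullet> (v j - z j))
      + \<eta> * \<beta> / 2 * (\<Sum>j=1..H. (norm (v j - z j))\<^sup>2) \<le> L v - L z"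
    using assms by (simp add: strongly_convex_def)
  then show ?thesis
    by (simp add: surrogate_loss_def sum_distrib_left)
qed

text \<open>The step displaces \<open>z\<close> by \<eta> times \<open>v - z\<close>, so the
  smoothness remainder carries \<eta> squared; taking out one factor \<eta> leaves the coefficient
  \<eta>\<beta>/2 of the passed loss.\<close>

lemma smooth_step:
  assumes "smooth H \<beta> L"
  shows "L (\<lambda>j. (1 - \<eta>) *\<^sub>R z j + \<eta> *\<^sub>R v j) \<le> L z + \<eta> * surrogate_loss \<eta> \<beta> H L z v"
proof -
  let ?y = "\<lambda>j. (1 - \<eta>) *\<^sub>R z j + \<eta> *\<^sub>R v j"
  have y: "?y j - z j = \<eta> *\<^sub>R (v j - z j)" for j
    by (simp add: algebra_simps)
  have "L ?y - L z \<le> (\<Sum>j=1..H. gradient j L z \<bullet> (?y j - z j))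
      + \<beta> / 2 * (\<Sum>j=1..H. (norm (?y j - z j))\<^sup>2)"
    using assms unfolding smooth_def by blast
  also have "\<dots> = \<eta> * surrogate_loss \<eta> \<beta> H L z v"
    unfolding y surrogate_loss_def
    by (simp add: sum_distrib_left power_mult_distrib distrib_left)
      (simp add: power2_eq_square mult_ac)
  finally show ?thesis by simp
qed

text \<open>Between two fixed points the gradient terms of both inequalities cancel and only the
  quadratic terms remain. This keeps the step size \<alpha>/\<beta> at most 1.\<close>

lemma strongly_convex_smooth_le:
  fixes L :: "'u::euclidean_space window_loss"
  assumes "strongly_convex H \<alpha> L" "smooth H \<beta> L" "1 \<le> H"
  shows "\<alpha> \<le> \<beta>"
proof -
  obtain b :: 'u where b: "b \<in> Basis" using nonempty_Basis by blast
  \<comment> \<open>A unit vector in each position makes the sum of squares \<open>?S\<close> equal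
    to \<open>H\<close>, which is positive and can be divided out.\<close>
  let ?v = "\<lambda>_::nat. b" and ?v' = "\<lambda>_::nat. 0 :: 'u"
  let ?g = "\<Sum>j=1..H. gradient j L ?v' \<bullet> (?v j - ?v' j)"
  let ?S = "\<Sum>j=1..H. (norm (?v j - ?v' j))\<^sup>2"
  have "?g + \<alpha> / 2 * ?S \<le> L ?v - L ?v'"
    using assms(1)[unfolded strongly_convex_def, THEN conjunct2, rule_format, of ?v' ?v] .
  also have "L ?v - L ?v' \<le> ?g + \<beta> / 2 * ?S"
    using assms(2)[unfolded smooth_def, THEN conjunct2, rule_format, of ?v ?v'] .
  finally have "\<alpha> / 2 * ?S \<le> \<beta> / 2 * ?S" by simp
  moreover have "?S = real H" using b by simp
  ultimately show ?thesis using \<open>1 \<le> H\<close> by simp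
qed

section \<open>Windows, memory error and the recursion over stages\<close>

lemma window_convex_comb:
  fixes a b :: "nat \<Rightarrow> 'a::real_vector"
  shows "window H t (\<lambda>t. (1 - \<theta>) *\<^sub>R a t + \<theta> *\<^sub>R b t) =
    (\<lambda>j. (1 - \<theta>) *\<^sub>R window H t a j + \<theta> *\<^sub>R window H t b j)"
  by (auto simp: window_def fun_eq_iff)

text \<open>Early windows are padded with 0, so the bound on \<open>\<U>\<close> applies to them
  because 0 is itself an action.\<close>

lemma bounded_loss_window:
  assumes "bounded_loss \<U> H G L" "0 \<in> \<U>" "\<And>s. s \<in> {1..T} \<Longrightarrow> a s \<in> \<U>" "t \<le> T"
  shows "\<bar>L (window H t a)\<bar> \<le> G"
proof -
  have "window H t a j \<in> \<U>" for j
    using assms(2,4) by (auto simp: window_def intro!: assms(3))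
  then show ?thesis
    using assms(1) by (simp add: bounded_loss_def)
qed

lemma loss_cong:
  assumes "\<And>s. 1 \<le> s \<Longrightarrow> s \<le> t \<Longrightarrow> a s = b s" "1 \<le> t"
  shows "loss f x1 w c a t = loss f x1 w c b t"
  using assms state_at_cong[of t a b f x1 w] by (simp add: loss_def)

lemma sum_loss_proxy:
  assumes "bounded_memory f x1 w c \<U> T H \<epsilon> a"
  shows "\<bar>(\<Sum>t=1..T. proxy_loss f w c H t (window H t a)) - (\<Sum>t=1..T. loss f x1 w c a t)\<bar>
    \<le> real T * \<epsilon>"
proof -
  have "\<bar>\<Sum>t=1..T. proxy_loss f w c H t (window H t a) - loss f x1 w c a t\<bar> \<le>
      (\<Sum>t=1..T. \<bar>proxy_loss f w c H t (window H t a) - loss f x1 w c a t\<bar>)"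
    by (rule sum_abs)
  also have "\<dots> \<le> (\<Sum>t=1..T. \<epsilon>)"
    using assms by (intro sum_mono) (auto simp: bounded_memory_def)
  finally show ?thesis by (simp add: sum_subtractf)
qed

lemma contraction_iterate:
  fixes D :: "nat \<Rightarrow> real"
  assumes "\<And>i. i < N \<Longrightarrow> D (Suc i) \<le> (1 - \<eta>) * D i + \<eta> * B" "D 0 \<le> K" "0 \<le> B" "0 \<le> \<eta>" "\<eta> \<le> 1"
  shows "D N \<le> (1 - \<eta>) ^ N * K + B"
proof -
  \<comment> \<open>The factor of \<open>B\<close> is the geometric sum \<eta> (1 + (1 - \<eta>) +
    ... + (1 - \<eta>)^(n-1)); keeping it exact lets the induction close.\<close>
  have "D n \<le> (1 - \<eta>) ^ n * K + (1 - (1 - \<eta>) ^ n) * B" if "n \<le> N" for n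
    using that
  proof (induction n)
    case (Suc n)
    have "D (Suc n) \<le> (1 - \<eta>) * D n + \<eta> * B"
      using Suc.prems by (intro assms(1)) simp
    also have "\<dots> \<le> (1 - \<eta>) * ((1 - \<eta>) ^ n * K + (1 - (1 - \<eta>) ^ n) * B) + \<eta> * B"
      using Suc assms by (intro add_right_mono mult_left_mono) auto
    also have "\<dots> = (1 - \<eta>) ^ Suc n * K + (1 - (1 - \<eta>) ^ Suc n) * B"
      by (simp add: algebra_simps)
    finally show ?case .
  qed (use assms in simp)
  from this[of N] have "D N \<le> (1 - \<eta>) ^ N * K + (B - (1 - \<eta>) ^ N * B)"
    by (simp add: algebra_simps)
  moreover have "0 \<le> (1 - \<eta>) ^ N * B" using assms by simp
  ultimately show ?thesis by simp
qed

section \<open>The regret bound for the closed loop\<close>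

theorem theorem3p3:
  fixes f :: "real ^ 'k \<Rightarrow> real ^ 'd \<Rightarrow> real ^ 'k"
    and x1 :: "real ^ 'k"
    and \<U> :: "(real ^ 'd) set"
    and w :: "nat \<Rightarrow> real ^ 'k"
    and c :: "nat \<Rightarrow> real ^ 'k \<Rightarrow> real ^ 'd \<Rightarrow> real"
    and \<P> :: "(real ^ 'k, real ^ 'd) policy set"
    and \<A> :: "nat \<Rightarrow> (real ^ 'k, real ^ 'd) controller"
    and R :: "nat \<Rightarrow> real"
    and H T N :: nat
    and W \<epsilon> \<alpha> \<beta> G :: real
    and x :: "nat \<Rightarrow> real ^ 'k" and u :: "nat \<Rightarrow> real ^ 'd"
    and L :: "nat \<Rightarrow> (real ^ 'd) window_loss"
  assumes parameters: "1 \<le> H" "0 < \<alpha>" "0 < \<beta>"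
    and action_set: "convex \<U>" "bounded \<U>"
    and perturbations: "\<And>t. t \<in> {1..T} \<Longrightarrow> norm (w t) \<le> W"
    and costs: "\<And>t. t \<in> {1..T} \<Longrightarrow> convex_on (UNIV \<times> \<U>) (\<lambda>(y, a). c t y a)"
    and closed_convex_comb: "\<And>a b \<theta>. bounded_memory f x1 w c \<U> T H \<epsilon> a \<Longrightarrow>
        bounded_memory f x1 w c \<U> T H \<epsilon> b \<Longrightarrow> 0 \<le> \<theta> \<Longrightarrow> \<theta> \<le> 1 \<Longrightarrow>
        bounded_memory f x1 w c \<U> T H \<epsilon> (\<lambda>t. (1 - \<theta>) *\<^sub>R a t + \<theta> *\<^sub>R b t)"
    and zero_memory: "bounded_memory f x1 w c \<U> T H \<epsilon> (\<lambda>_. 0)"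
    and policies: "\<P> \<noteq> {}"
      "\<And>\<pi>. \<pi> \<in> \<P> \<Longrightarrow> bounded_memory f x1 w c \<U> T H \<epsilon> (policy_actions w \<pi>)"
    and proxy: "L = proxy_loss f w c H"
    and losses: "\<And>t. t \<in> {1..T} \<Longrightarrow> L t \<in> booster_losses \<U> H \<alpha> \<beta> G"
    and run: "u = played f x1 w L (dynaboost2 \<A> N \<alpha> \<beta> H)" "x = state_at f x1 w u"
    and rate: "regret_bound R"
    and weak_memory: "\<And>i. i \<in> {1..N} \<Longrightarrow>
        bounded_memory f x1 w c \<U> T H \<epsilon> (weak_action \<A> \<alpha> \<beta> H x w L i)"
    and weak_regret: "\<And>i. i \<in> {1..N} \<Longrightarrow>
        (\<And>t. t \<in> {1..T} \<Longrightarrow> passed_loss \<A> \<alpha> \<beta> H x w L i t \<in> weak_losses H \<alpha>) \<Longrightarrow>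
        truncated_regret w H (passed_loss \<A> \<alpha> \<beta> H x w L i) \<P> T (weak_action \<A> \<alpha> \<beta> H x w L i)
          \<le> R T + 2 * real T * \<epsilon>"
  shows "(\<forall>t\<in>{1..T}. u t \<in> \<U>) \<and>
    regret f x1 w c \<P> T u \<le> (1 - \<alpha> / \<beta>) ^ N * 2 * G * real T + R T + 4 * real T * \<epsilon>"
\<comment> \<open>With no rounds the regret is 0 and the claim is non-negativity of
  \<open>R 0\<close>. Otherwise round 1 supplies a loss, from which \<alpha> \<le> \<beta> is read
  off, and an instance of the memory bound.\<close>
proof (cases "T = 0")
  case True
  then show ?thesis
    using rate policies(1) by (simp add: regret_def regret_bound_def)
next
  case False
  then have T: "1 \<in> {1..T}" by simp
  define \<eta> where "\<eta> = \<alpha> / \<beta>"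
  define s where "s = stage_action \<A> \<alpha> \<beta> H x w L"
  define a where "a = weak_action \<A> \<alpha> \<beta> H x w L"
  define q where "q = passed_loss \<A> \<alpha> \<beta> H x w L"
  define P where "P b = (\<Sum>t=1..T. L t (window H t b))" for b
  define B where "B = R T + 2 * real T * \<epsilon>"
  have L: "strongly_convex H \<alpha> (L t)" "smooth H \<beta> (L t)" "bounded_loss \<U> H G (L t)"
    if "t \<in> {1..T}" for t
    using losses[OF that] by (auto simp: booster_losses_def)
  have \<eta>\<beta>: "\<eta> * \<beta> = \<alpha>" using parameters by (simp add: \<eta>_def)
  have "\<alpha> \<le> \<beta>"
    using strongly_convex_smooth_le[OF L(1,2)[OF T] parameters(1)] .
  then have \<eta>: "0 < \<eta>" "\<eta> \<le> 1" using parameters by (auto simp: \<eta>_def)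
  \<comment> \<open>Both are read off from the zero sequence in round 1: its action lies in
    \<open>\<U>\<close>, and \<epsilon> dominates an absolute value.\<close>
  have zero: "0 \<in> \<U>" and "0 \<le> \<epsilon>"
    using zero_memory T unfolding bounded_memory_def by (blast, fastforce)
  moreover have "0 \<le> R T"
    using rate by (auto simp: regret_bound_def mono_def intro: order_trans)
  ultimately have B: "0 \<le> B" by (simp add: B_def)
  have s_Suc: "s (Suc i) = (\<lambda>t. (1 - \<eta>) *\<^sub>R s i t + \<eta> *\<^sub>R a (Suc i) t)" for i
    by (simp only: s_def a_def \<eta>_def stage_action_weak_action fun_eq_iff) simp
  \<comment> \<open>Copy \<open>Suc i\<close> receives the quadratic built around stage
    \<open>i\<close>, the stage just before its own.\<close>
  have q_eq: "q (Suc i) t = surrogate_loss \<eta> \<beta> H (L t) (window H t (s i))" for i t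
    by (simp add: q_def passed_loss_def s_def \<eta>_def)
  \<comment> \<open>Stage 0 is the zero sequence, and each later stage is a convex combination of
    the previous one with a weak controller's actions.\<close>
  have memory: "bounded_memory f x1 w c \<U> T H \<epsilon> (s i)" if "i \<le> N" for i
    using that
  proof (induction i)
    case 0
    then show ?case using zero_memory by (simp add: s_def)
  next
    case (Suc i)
    then show ?case
      unfolding s_Suc using \<eta> by (intro closed_convex_comb) (auto simp: a_def intro!: weak_memory)
  qed
  have u_eq: "u t = s N t" if "1 \<le> t" for t
    using played_dynaboost2[OF that run(1)] by (simp add: s_def run(2))
  \<comment> \<open>Agreement from round 1 on suffices: windows never read index 0.\<close>
  have u_window: "window H t u = window H t (s N)" for t
    using u_eq by (auto simp: window_def fun_eq_iff)
  have actions: "u t \<in> \<U>" if "t \<in> {1..T}" for t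
    using memory[of N] that u_eq by (auto simp: bounded_memory_def)
  have P_loss: "\<bar>P b - (\<Sum>t=1..T. loss f x1 w c b t)\<bar> \<le> real T * \<epsilon>"
    if "bounded_memory f x1 w c \<U> T H \<epsilon> b" for b
    unfolding P_def proxy by (rule sum_loss_proxy[OF that])
  have P_bound: "\<bar>P b\<bar> \<le> real T * G" if "bounded_memory f x1 w c \<U> T H \<epsilon> b" for b
  proof -
    have "\<bar>P b\<bar> \<le> (\<Sum>t=1..T. \<bar>L t (window H t b)\<bar>)"
      unfolding P_def by (rule sum_abs)
    also have "\<dots> \<le> (\<Sum>t=1..T. G)"
      using that zero by (intro sum_mono bounded_loss_window[where T = T, OF L(3)]) (auto simp: bounded_memory_def)
    finally show ?thesis by simp
  qed
  have bdd: "bdd_below ((\<lambda>\<pi>. \<Sum>t=1..T. q (Suc i) t (window H t (policy_actions w \<pi>))) ` \<P>)" for i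
    unfolding q_eq using \<eta>\<beta> parameters
    by - (rule bdd_belowI2, rule sum_mono, rule surrogate_loss_lower_bound, simp)
  have excess: "P u - P (policy_actions w \<pi>) \<le> (1 - \<eta>) ^ N * (2 * G * real T) + B"
    if "\<pi> \<in> \<P>" for \<pi>
  proof -
    let ?p = "policy_actions w \<pi>"
    have step: "P (s (Suc i)) - P ?p \<le> (1 - \<eta>) * (P (s i) - P ?p) + \<eta> * B" if "i < N" for i
    proof -
      let ?Q = "\<lambda>b. \<Sum>t=1..T. q (Suc i) t (window H t b)"
      \<comment> \<open>The premise of the weak guarantee is met by
        \<open>surrogate_loss_weak\<close>, since \<eta>\<beta> = \<alpha>.\<close>
      have "?Q (a (Suc i)) - (INF \<pi>\<in>\<P>. ?Q (policy_actions w \<pi>)) \<le> B"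
        using weak_regret[of "Suc i"] that \<eta>\<beta>
        by (simp add: truncated_regret_def a_def B_def q_def[symmetric] q_eq surrogate_loss_weak)
      moreover have "(INF \<pi>\<in>\<P>. ?Q (policy_actions w \<pi>)) \<le> ?Q ?p"
        using \<open>\<pi> \<in> \<P>\<close> by (rule cINF_lower[OF bdd])
      moreover have "?Q ?p \<le> P ?p - P (s i)"
        unfolding P_def sum_subtractf[symmetric] q_eq
        using L(1) \<eta>\<beta> by (intro sum_mono surrogate_loss_le_diff) simp
      ultimately have "?Q (a (Suc i)) \<le> P ?p - P (s i) + B" by linarith
      then have "\<eta> * ?Q (a (Suc i)) \<le> \<eta> * (P ?p - P (s i) + B)"
        using \<eta> by (intro mult_left_mono) auto
      \<comment> \<open>Windows commute with convex combinations, padding included, so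
        \<open>smooth_step\<close> applies in every round.\<close>
      moreover have "P (s (Suc i)) \<le> P (s i) + \<eta> * ?Q (a (Suc i))"
        unfolding P_def s_Suc sum_distrib_left sum.distrib[symmetric] q_eq window_convex_comb
        using L(2) by (intro sum_mono smooth_step)
      ultimately show ?thesis by (simp add: algebra_simps)
    qed
    \<comment> \<open>Both sums are at most \<open>G\<close> times \<open>T\<close> in absolute
      value, whence the factor 2.\<close>
    have "P (s 0) - P ?p \<le> 2 * G * real T"
      using P_bound[OF memory[of 0]] P_bound[OF policies(2)[OF \<open>\<pi> \<in> \<P>\<close>]] by (simp add: abs_le_iff algebra_simps)
    then have "P (s N) - P ?p \<le> (1 - \<eta>) ^ N * (2 * G * real T) + B"
      using \<eta> B step by (intro contraction_iterate[of N "\<lambda>i. P (s i) - P ?p"]) auto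
    then show ?thesis by (simp add: P_def u_window)
  qed
  have u_memory: "bounded_memory f x1 w c \<U> T H \<epsilon> u"
  proof -
    have "loss f x1 w c u t = loss f x1 w c (s N) t" if "1 \<le> t" for t
      using u_eq that by (intro loss_cong) auto
    then show ?thesis
      using memory[of N] u_eq u_window by (simp add: bounded_memory_def)
  qed
  have "(\<Sum>t=1..T. loss f x1 w c u t) - ((1 - \<eta>) ^ N * (2 * G * real T) + B + 2 * real T * \<epsilon>) \<le>
      (INF \<pi>\<in>\<P>. \<Sum>t=1..T. loss f x1 w c (policy_actions w \<pi>) t)"
  \<comment> \<open>The bound holds against each policy separately, so no minimizing policy is
    required. Leaving the proxy losses for \<open>u\<close> and for the policy costs T\<epsilon>
    each; with the 2T\<epsilon> inside \<open>B\<close> this makes 4T\<epsilon>.\<close>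
  proof (rule cINF_greatest[OF policies(1)])
    fix \<pi> assume "\<pi> \<in> \<P>"
    from excess[OF this] P_loss[OF u_memory] P_loss[OF policies(2)[OF this]]
    show "(\<Sum>t=1..T. loss f x1 w c u t) - ((1 - \<eta>) ^ N * (2 * G * real T) + B + 2 * real T * \<epsilon>) \<le>
        (\<Sum>t=1..T. loss f x1 w c (policy_actions w \<pi>) t)"
      by linarith
  qed
  then have "regret f x1 w c \<P> T u \<le> (1 - \<eta>) ^ N * (2 * G * real T) + B + 2 * real T * \<epsilon>"
    by (simp add: regret_def)
  also have "\<dots> = (1 - \<alpha> / \<beta>) ^ N * 2 * G * real T + R T + 4 * real T * \<epsilon>"
    by (simp add: \<eta>_def B_def)
  finally show ?thesis
    using actions by blast
qed

end
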